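(* For every odd $r\ge 3$, $2^r\le \zeta_e(BF(r))\le \left\lceil \frac{r}{2}\right\rceil 2^{r-1}$.
   Context: The $r$-dimensional butterfly network $BF(r)$ has vertex set $\{[w;i] : w\in\{0,1\}^r,\ 0\le i\le r\}$, and $[w;i]$ is adjacent to $[w';j]$ iff $j=i+1$ and either $w=w'$ or $w$ and $w'$ differ precisely in the $j$-th bit. Forcing (closure) rule: for a graph $G=(V,E)$ and $T\subseteq V$, the closure $C_G(T)$ starts as $T$ and, as long as some vertex of $C_G(T)$ has exactly one neighbor not in $C_G(T)$, that neighbor is added. Edge-forcing set: a set $K$ of pairwise independent edges of $G$ such that, with $T$ the set of endpoints of edges of $K$, $C_G(T)=V$. $\zeta_e(G)$ is the minimum cardinality of an edge-forcing set of $G$. *)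

theory Defs
  imports Complex_Main
begin

text \<open>
  A finite simple graph is given by a vertex set \<open>V\<close> and a set \<open>E\<close> of two-element subsets of \<open>V\<close>.
\<close>

definition nbhd :: "'a set set \<Rightarrow> 'a \<Rightarrow> 'a set" where
  "nbhd E u = {v. {u, v} \<in> E}"

definition force_step :: "'a set set \<Rightarrow> 'a set \<Rightarrow> 'a set \<Rightarrow> bool" where
  "force_step E S S' \<longleftrightarrow> (\<exists>u\<in>S. \<exists>v. nbhd E u - S = {v} \<and> S' = insert v S)"

text \<open>
  The closure is the outcome of applying the forcing rule for as long as possible; the lemma
  \<open>forcing_closure_ex1\<close> below shows that this outcome exists and does not depend on the order of
  the forces.
\<close>

definition forcing_closure :: "'a set set \<Rightarrow> 'a set \<Rightarrow> 'a set" where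
  "forcing_closure E T = (THE C. (force_step E)\<^sup>*\<^sup>* T C \<and> (\<nexists>C'. force_step E C C'))"

definition edge_forcing_set :: "'a set \<Rightarrow> 'a set set \<Rightarrow> 'a set set \<Rightarrow> bool" where
  "edge_forcing_set V E K \<longleftrightarrow>
     K \<subseteq> E \<and> pairwise disjnt K \<and> forcing_closure E (\<Union>K) = V"

definition edge_forcing_number :: "'a set \<Rightarrow> 'a set set \<Rightarrow> nat" where
  "edge_forcing_number V E = (LEAST n. \<exists>K. edge_forcing_set V E K \<and> card K = n)"

definition BF_verts :: "nat \<Rightarrow> (bool list \<times> nat) set" where
  "BF_verts r = {(w, i). length w = r \<and> i \<le> r}"

text \<open>Bits are numbered from 1, so the \<open>k\<close>-th bit of \<open>w\<close> is \<open>w ! (k - 1)\<close>.\<close>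

definition differ_precisely_in_bit :: "nat \<Rightarrow> bool list \<Rightarrow> bool list \<Rightarrow> bool" where
  "differ_precisely_in_bit j w w' \<longleftrightarrow>
     length w = length w' \<and> (\<forall>k\<in>{1..length w}. w ! (k - 1) \<noteq> w' ! (k - 1) \<longleftrightarrow> k = j)"

definition BF_edges :: "nat \<Rightarrow> (bool list \<times> nat) set set" where
  "BF_edges r =
     {{(w, i), (w', j)} | w i w' j.
        (w, i) \<in> BF_verts r \<and> (w', j) \<in> BF_verts r \<and>
        j = i + 1 \<and> (w = w' \<or> differ_precisely_in_bit j w w')}"

lemma force_steps_subset_closed:
  assumes "(force_step E)\<^sup>*\<^sup>* T C" "T \<subseteq> D" "\<nexists>D'. force_step E D D'"
  shows "C \<subseteq> D"
  using assms(1)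
proof (induction rule: rtranclp_induct)
  case base
  show ?case by (rule assms(2))
next
  case (step S S')
  then obtain u v where uv: "u \<in> S" "nbhd E u - S = {v}" "S' = insert v S"
    by (auto simp: force_step_def)
  have "v \<in> D"
  proof (rule ccontr)
    assume "v \<notin> D"
    with uv step.IH have "nbhd E u - D = {v}" by blast
    with uv step.IH have "force_step E D (insert v D)"
      by (auto simp: force_step_def)
    with assms(3) show False by blast
  qed
  with uv step.IH show ?case by simp
qed

lemma force_steps_increasing: "(force_step E)\<^sup>*\<^sup>* T C \<Longrightarrow> T \<subseteq> C"
  by (induction rule: rtranclp_induct) (auto simp: force_step_def)

lemma force_steps_terminate:
  assumes "finite V" "\<Union>E \<subseteq> V" "T \<subseteq> V"
  shows "\<exists>C. (force_step E)\<^sup>*\<^sup>* T C \<and> (\<nexists>C'. force_step E C C')"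
  using assms(3)
proof (induction "card (V - T)" arbitrary: T rule: less_induct)
  case less
  show ?case
  proof (cases "\<exists>T'. force_step E T T'")
    case False
    then show ?thesis by blast
  next
    case True
    then obtain T' u v where T': "force_step E T T'" "u \<in> T" "nbhd E u - T = {v}" "T' = insert v T"
      unfolding force_step_def by blast
    then have v: "{u, v} \<in> E" "v \<notin> T" by (auto simp: nbhd_def)
    with assms(2) have "v \<in> V" by blast
    with v T'(4) have "V - T' \<subset> V - T" by blast
    then have "card (V - T') < card (V - T)"
      using assms(1) by (simp add: psubset_card_mono)
    moreover have "T' \<subseteq> V" using \<open>v \<in> V\<close> less.prems T'(4) by simp
    ultimately obtain C where "(force_step E)\<^sup>*\<^sup>* T' C" "\<nexists>C'. force_step E C C'"
      using less.hyps by blast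
    with T'(1) show ?thesis by (meson converse_rtranclp_into_rtranclp)
  qed
qed

lemma forcing_closure_ex1:
  assumes "finite V" "\<Union>E \<subseteq> V" "T \<subseteq> V"
  shows "\<exists>!C. (force_step E)\<^sup>*\<^sup>* T C \<and> (\<nexists>C'. force_step E C C')"
proof (rule ex_ex1I)
  show "\<exists>C. (force_step E)\<^sup>*\<^sup>* T C \<and> (\<nexists>C'. force_step E C C')"
    by (rule force_steps_terminate[OF assms])
  show "C = D"
    if "(force_step E)\<^sup>*\<^sup>* T C \<and> (\<nexists>C'. force_step E C C')"
      and "(force_step E)\<^sup>*\<^sup>* T D \<and> (\<nexists>C'. force_step E D C')" for C D
    using that by (meson force_steps_increasing force_steps_subset_closed subset_antisym)
qed

end

theory Submission
  imports Defs
begin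

text \<open>
  Lower bound: two vertices of level 0 whose words differ in the first bit have the same
  neighbours, so neither can ever be forced before the other, and every forcing set meets
  the pair; the same holds at level \<open>r\<close> with the last bit. This gives \<open>2 ^ r\<close> disjoint pairs, and
  as levels 0 and \<open>r\<close> are not adjacent, one edge meets at most one of them.

  Upper bound: between the levels \<open>2 k\<close> and \<open>2 k + 1\<close> the graph is a disjoint union of
  \<open>2 ^ (r - 1)\<close> four-cycles; take one edge of each. Going up from level 0, each chosen vertex of
  level \<open>2 k\<close> forces the missing vertex of level \<open>2 k + 1\<close>, since level \<open>2 k - 1\<close> is already full.
  Going down from level \<open>r\<close>, the even levels fill up in the same way.
\<close>

section \<open>Forcing closures\<close>

lemma
  assumes "finite V" "\<Union>E \<subseteq> V" "T \<subseteq> V"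
  shows forcing_closure_steps: "(force_step E)\<^sup>*\<^sup>* T (forcing_closure E T)"
    and forcing_closure_stuck: "\<nexists>C'. force_step E (forcing_closure E T) C'"
  using theI'[OF forcing_closure_ex1[OF assms]] unfolding forcing_closure_def by blast+

lemma forcing_closure_least:
  assumes "finite V" "\<Union>E \<subseteq> V" "T \<subseteq> V" "T \<subseteq> D" "\<nexists>D'. force_step E D D'"
  shows "forcing_closure E T \<subseteq> D"
  using forcing_closure_steps[OF assms(1-3)] assms(4,5) by (rule force_steps_subset_closed)

text \<open>This replaces explicit forcing sequences: if \<open>v\<close> were missing,
  \<open>u\<close> could still force it, but the closure admits no further step.\<close>

lemma forcing_closure_forced:
  assumes "finite V" "\<Union>E \<subseteq> V" "T \<subseteq> V"
    and "u \<in> forcing_closure E T" "v \<in> nbhd E u" "nbhd E u - {v} \<subseteq> forcing_closure E T"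
  shows "v \<in> forcing_closure E T"
proof (rule ccontr)
  assume "v \<notin> forcing_closure E T"
  with assms(5,6) have "nbhd E u - forcing_closure E T = {v}" by blast
  with assms(4) have "force_step E (forcing_closure E T) (insert v (forcing_closure E T))"
    unfolding force_step_def by blast
  with forcing_closure_stuck[OF assms(1-3)] show False by blast
qed

text \<open>The set \<open>V - {x, y}\<close> is stuck: a vertex adjacent to one twin is adjacent to
  both, so it never has exactly one missing neighbour. Hence a start inside this set stays inside
  it.\<close>

lemma edge_forcing_set_meets_twins:
  assumes "finite V" "\<Union>E \<subseteq> V" "edge_forcing_set V E K"
    and "x \<in> V" "x \<noteq> y" "nbhd E x = nbhd E y"
  shows "x \<in> \<Union>K \<or> y \<in> \<Union>K"
proof (rule ccontr)
  assume "\<not> ?thesis"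
  moreover have T: "\<Union>K \<subseteq> V" and C: "forcing_closure E (\<Union>K) = V"
    using assms(2,3) unfolding edge_forcing_set_def by blast+
  ultimately have "\<Union>K \<subseteq> V - {x, y}" by blast
  moreover have "\<nexists>D'. force_step E (V - {x, y}) D'"
  proof
    assume "\<exists>D'. force_step E (V - {x, y}) D'"
    then obtain u v where uv: "nbhd E u - (V - {x, y}) = {v}"
      unfolding force_step_def by blast
    then have "{u, v} \<in> E" by (auto simp: nbhd_def)
    with assms(2) uv have "v = x \<or> v = y" by blast
    with \<open>{u, v} \<in> E\<close> have "u \<in> nbhd E x \<or> u \<in> nbhd E y"
      by (auto simp: nbhd_def insert_commute)
    with assms(6) have "u \<in> nbhd E x" "u \<in> nbhd E y" by auto
    then have "x \<in> nbhd E u" "y \<in> nbhd E u" by (auto simp: nbhd_def insert_commute)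
    then have "x \<in> {v}" "y \<in> {v}" unfolding uv[symmetric] by auto
    with assms(5) show False by blast
  qed
  ultimately have "V \<subseteq> V - {x, y}"
    using forcing_closure_least[OF assms(1,2) T] C by simp
  with assms(4) show False by blast
qed

section \<open>The butterfly network\<close>

text \<open>Positions count from 0, so \<open>flip i\<close> changes bit \<open>Suc i\<close>, the
  bit that governs the cross edges between levels \<open>i\<close> and \<open>Suc i\<close>.\<close>

definition flip :: "nat \<Rightarrow> bool list \<Rightarrow> bool list" where
  "flip i w = w[i := \<not> w ! i]"

lemma length_flip [simp]: "length (flip i w) = length w"
  by (simp add: flip_def)

lemma flip_flip [simp]: "flip i (flip i w) = w"
  by (cases "i < length w") (auto simp: flip_def list_update_beyond)

lemma nth_flip: "i < length w \<Longrightarrow> flip i w ! i = (\<not> w ! i)"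
  by (simp add: flip_def)

lemma differ_precisely_in_bit_iff_flip:
  assumes "i < length w"
  shows "differ_precisely_in_bit (Suc i) w w' \<longleftrightarrow> w' = flip i w"
proof -
  have "(\<forall>k\<in>{1..length w}. (w ! (k - 1) \<noteq> w' ! (k - 1)) = (k = Suc i)) \<longleftrightarrow>
        (\<forall>k<length w. (w ! k \<noteq> w' ! k) = (k = i))"
    (is "?L \<longleftrightarrow> ?R")
  proof
    assume L: ?L
    show ?R
    proof (intro allI impI)
      fix k assume "k < length w"
      with L[rule_format, of "Suc k"] show "(w ! k \<noteq> w' ! k) = (k = i)" by simp
    qed
  next
    assume R: ?R
    show ?L
    proof
      fix k assume "k \<in> {1..length w}"
      with R[rule_format, of "k - 1"] show "(w ! (k - 1) \<noteq> w' ! (k - 1)) = (k = Suc i)" by auto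
    qed
  qed
  moreover have "w' = flip i w \<longleftrightarrow>
      length w = length w' \<and> (\<forall>k<length w. (w ! k \<noteq> w' ! k) = (k = i))"
    unfolding list_eq_iff_nth_eq flip_def by (fastforce simp: nth_list_update)
  ultimately show ?thesis unfolding differ_precisely_in_bit_def by blast
qed

lemma BF_edges_iff:
  "{(w, i), (w', j)} \<in> BF_edges r \<longleftrightarrow>
     length w = r \<and> length w' = r \<and>
     (j = Suc i \<and> i < r \<and> (w' = w \<or> w' = flip i w) \<or>
      i = Suc j \<and> j < r \<and> (w' = w \<or> w' = flip j w))"
proof -
  have *: "(w = w' \<or> differ_precisely_in_bit (Suc i) w w') \<longleftrightarrow> (w' = w \<or> w' = flip i w)"
    if "length w = r" "i < r" for w w' :: "bool list" and i
    using that by (auto simp: differ_precisely_in_bit_iff_flip)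
  have flip_sym: "w = flip j w' \<longleftrightarrow> w' = flip j w" for w w' j
    by (metis flip_flip)
  \<comment> \<open>\<open>up\<close> orients an edge from the lower level to the higher one. An
    unordered pair can be read both ways, and since \<open>flip j\<close> is an involution the
    reversed reading has the same form.\<close>
  define up where "up w i w' j \<longleftrightarrow> (w, i) \<in> BF_verts r \<and> (w', j) \<in> BF_verts r \<and>
      j = i + 1 \<and> (w = w' \<or> differ_precisely_in_bit j w w')" for w i w' j
  have "{(w, i), (w', j)} \<in> BF_edges r \<longleftrightarrow> up w i w' j \<or> up w' j w i"
    unfolding BF_edges_def up_def[symmetric] mem_Collect_eq doubleton_eq_iff prod.inject by blast
  also have "\<dots> \<longleftrightarrow> length w = r \<and> length w' = r \<and>
     (j = Suc i \<and> i < r \<and> (w = w' \<or> differ_precisely_in_bit (Suc i) w w') \<or>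
      i = Suc j \<and> j < r \<and> (w' = w \<or> differ_precisely_in_bit (Suc j) w' w))"
    unfolding up_def BF_verts_def by auto
  also have "\<dots> \<longleftrightarrow> length w = r \<and> length w' = r \<and>
     (j = Suc i \<and> i < r \<and> (w' = w \<or> w' = flip i w) \<or>
      i = Suc j \<and> j < r \<and> (w' = w \<or> w' = flip j w))"
    using *[of w i w'] *[of w' j w] flip_sym[of w j w'] by argo
  finally show ?thesis .
qed

text \<open>Writing the lower level as \<open>i = Suc j\<close> makes the second set empty at level
  0, so one formula serves all levels.\<close>

lemma nbhd_BF_edges:
  assumes "length w = r" "i \<le> r"
  shows "nbhd (BF_edges r) (w, i) =
    {(w', j). (w' = w \<or> w' = flip i w) \<and> j = Suc i \<and> i < r} \<union>
    {(w', j). (w' = w \<or> w' = flip j w) \<and> i = Suc j}"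
  using assms by (auto simp: nbhd_def BF_edges_iff)

lemma finite_BF_verts: "finite (BF_verts r)"
proof -
  have "BF_verts r = {w. length w = r} \<times> {..r}"
    by (auto simp: BF_verts_def)
  then show ?thesis
    using finite_lists_length_eq[of "UNIV :: bool set" r] by simp
qed

lemma Union_BF_edges_subset: "\<Union>(BF_edges r) \<subseteq> BF_verts r"
  by (auto simp: BF_edges_def)

lemma finite_BF_edges: "finite (BF_edges r)"
  using finite_BF_verts Union_BF_edges_subset by (metis finite_UnionD finite_subset)

lemma card_bool_lists_length: "card {w :: bool list. length w = n} = 2 ^ n"
  using card_lists_length_eq[of "UNIV :: bool set" n] by simp

section \<open>Lower bound\<close>

text \<open>The first bit of an index word selects a twin pair on level 0 or on level \<open>r\<close>.\<close>

definition twin_pair :: "bool list \<Rightarrow> (bool list \<times> nat) set" where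
  "twin_pair w =
     (if hd w then {(tl w @ [False], length w), (tl w @ [True], length w)}
      else {(False # tl w, 0), (True # tl w, 0)})"

lemma edge_forcing_set_meets_twin_pair:
  assumes "edge_forcing_set (BF_verts r) (BF_edges r) K" "length w = r" "r > 0"
  shows "\<exists>e\<in>K. e \<inter> twin_pair w \<noteq> {}"
proof -
  obtain b u where w: "w = b # u" and r: "r = Suc (length u)"
    using assms(2,3) by (cases w) auto
  note meets = edge_forcing_set_meets_twins
    [OF finite_BF_verts Union_BF_edges_subset assms(1)]
  show ?thesis
  proof (cases b)
    case True
    \<comment> \<open>Flipping the last bit swaps the two words, and level \<open>r\<close> has no
      neighbours above.\<close>
    have "nbhd (BF_edges r) (u @ [False], r) = nbhd (BF_edges r) (u @ [True], r)"
      by (auto simp: nbhd_BF_edges r flip_def)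
    then have "(u @ [False], r) \<in> \<Union>K \<or> (u @ [True], r) \<in> \<Union>K"
      by (intro meets) (auto simp: BF_verts_def r)
    with True w r show ?thesis by (auto simp: twin_pair_def)
  next
    case False
    have "nbhd (BF_edges r) (False # u, 0) = nbhd (BF_edges r) (True # u, 0)"
      by (auto simp: nbhd_BF_edges r flip_def)
    then have "(False # u, 0) \<in> \<Union>K \<or> (True # u, 0) \<in> \<Union>K"
      by (intro meets) (auto simp: BF_verts_def r)
    with False w show ?thesis by (auto simp: twin_pair_def)
  qed
qed

text \<open>For \<open>r \<ge> 2\<close> the levels 0 and \<open>r\<close> are not consecutive, so
  both pairs are met in the same vertex. Its level gives the head of the index word and its own word
  gives the tail.\<close>

lemma BF_edge_meets_one_twin_pair:
  assumes "e \<in> BF_edges r" "r \<ge> 2" "length w = r" "length w' = r"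
    and "e \<inter> twin_pair w \<noteq> {}" "e \<inter> twin_pair w' \<noteq> {}"
  shows "w = w'"
proof -
  obtain x y where x: "x \<in> e" "x \<in> twin_pair w" and y: "y \<in> e" "y \<in> twin_pair w'"
    using assms(5,6) by blast
  have "snd x \<in> {0, r}" "snd y \<in> {0, r}"
    using x(2) y(2) assms(3,4) by (auto simp: twin_pair_def split: if_splits)
  moreover obtain v i v' where "e = {(v, i), (v', Suc i)}"
    using assms(1) unfolding BF_edges_def Suc_eq_plus1 by blast
  then have "x = y \<or> snd y = Suc (snd x) \<or> snd x = Suc (snd y)"
    using x(1) y(1) by auto
  moreover from calculation have "snd y \<noteq> Suc (snd x)" "snd x \<noteq> Suc (snd y)"
    using assms(2) by (elim insertE emptyE; linarith)+
  ultimately have "x = y" by blast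
  moreover obtain b u b' u' where "w = b # u" "w' = b' # u'"
    using assms(2-4) by (cases w; cases w') auto
  ultimately show ?thesis
    using x(2) y(2) assms(2-4) by (auto simp: twin_pair_def split: if_splits)
qed

lemma edge_forcing_set_BF_card_ge:
  assumes "edge_forcing_set (BF_verts r) (BF_edges r) K" "r \<ge> 2"
  shows "2 ^ r \<le> card K"
proof -
  have K: "K \<subseteq> BF_edges r" using assms(1) by (simp add: edge_forcing_set_def)
  from assms(2) have "r > 0" by simp
  \<comment> \<open>Choosing for each index word an edge of \<open>K\<close> that meets its pair
    gives an injection from the \<open>2 ^ r\<close> words into \<open>K\<close>.\<close>
  then have "\<forall>w. \<exists>e. length w = r \<longrightarrow> e \<in> K \<and> e \<inter> twin_pair w \<noteq> {}"
    using edge_forcing_set_meets_twin_pair[OF assms(1)] by blast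
  then obtain f where f: "\<And>w. length w = r \<Longrightarrow> f w \<in> K \<and> f w \<inter> twin_pair w \<noteq> {}"
    by metis
  have "inj_on f {w. length w = r}"
  proof (rule inj_onI)
    fix w w' assume "w \<in> {w. length w = r}" "w' \<in> {w. length w = r}" "f w = f w'"
    with f[of w] f[of w'] K assms(2) show "w = w'"
      by (intro BF_edge_meets_one_twin_pair[of "f w" r]) auto
  qed
  moreover have "f ` {w. length w = r} \<subseteq> K" using f by blast
  moreover have "finite K" using K finite_BF_edges finite_subset by blast
  ultimately have "card {w :: bool list. length w = r} \<le> card K" by (rule card_inj_on_le)
  then show ?thesis by (simp add: card_bool_lists_length)
qed

section \<open>Upper bound\<close>

text \<open>The four-cycle on the words \<open>w\<close> and \<open>flip i w\<close> contributes the
  straight edge of the word whose bit at position \<open>i\<close> is \<open>False\<close>.\<close>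

definition rungs :: "nat \<Rightarrow> (bool list \<times> nat) set set" where
  "rungs r = {{(w, i), (w, Suc i)} | w i. length w = r \<and> i < r \<and> even i \<and> \<not> w ! i}"

lemma rungs_subset_BF_edges: "rungs r \<subseteq> BF_edges r"
  by (auto simp: rungs_def BF_edges_iff)

lemma rung_ends:
  assumes "length w = r" "i < r" "even i" "\<not> w ! i"
  shows "(w, i) \<in> \<Union>(rungs r)" "(w, Suc i) \<in> \<Union>(rungs r)"
  using assms unfolding rungs_def by blast+

text \<open>Either endpoint determines its rung: the word is shared, and \<open>i\<close> is the
  even one of the two candidate levels.\<close>

lemma pairwise_disjnt_rungs: "pairwise disjnt (rungs r)"
  unfolding pairwise_def rungs_def disjnt_def by auto

text \<open>There are \<open>Suc r div 2\<close> even positions below \<open>r\<close>. For each, a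
  rung is given by its word with the fixed \<open>False\<close> bit deleted, which \<open>f\<close>
  puts back.\<close>

lemma card_rungs_le: "card (rungs r) \<le> Suc r div 2 * 2 ^ (r - 1)"
proof -
  define f :: "nat \<times> bool list \<Rightarrow> (bool list \<times> nat) set" where
    "f = (\<lambda>(k, u). let w = take (2 * k) u @ False # drop (2 * k) u
                   in {(w, 2 * k), (w, Suc (2 * k))})"
  define A :: "(nat \<times> bool list) set" where "A = {..<Suc r div 2} \<times> {u. length u = r - 1}"
  have "finite A"
    using finite_lists_length_eq[of "UNIV :: bool set" "r - 1"] by (simp add: A_def)
  moreover have "rungs r \<subseteq> f ` A"
  proof
    fix e assume "e \<in> rungs r"
    then obtain w i where e: "e = {(w, i), (w, Suc i)}"
      and w: "length w = r" "i < r" "even i" "\<not> w ! i"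
      by (auto simp: rungs_def)
    from w(3) obtain k where k: "i = 2 * k" by blast
    define u where "u = take i w @ drop (Suc i) w"
    have "w = take i u @ False # drop i u"
      using id_take_nth_drop[of i w] w by (simp add: u_def)
    then have "e = f (k, u)" unfolding f_def e k by (simp add: Let_def)
    moreover have "(k, u) \<in> A" using w k by (auto simp: A_def u_def)
    ultimately show "e \<in> f ` A" by blast
  qed
  ultimately have "card (rungs r) \<le> card A" by (rule surj_card_le)
  then show ?thesis by (simp add: A_def card_bool_lists_length card_cartesian_product)
qed

lemma forcing_closure_rungs:
  assumes "odd r"
  shows "forcing_closure (BF_edges r) (\<Union>(rungs r)) = BF_verts r"
proof -
  define C where "C = forcing_closure (BF_edges r) (\<Union>(rungs r))"
  have T: "\<Union>(rungs r) \<subseteq> BF_verts r"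
    using rungs_subset_BF_edges Union_BF_edges_subset by blast
  note closure = finite_BF_verts Union_BF_edges_subset T
  have TC: "\<Union>(rungs r) \<subseteq> C"
    unfolding C_def using forcing_closure_steps[OF closure] by (rule force_steps_increasing)
  note forced = forcing_closure_forced[OF closure, folded C_def]
  have rung: "(w, i) \<in> C" "(w, Suc i) \<in> C"
    if "length w = r" "i < r" "even i" "\<not> w ! i" for w i
    using rung_ends[OF that] TC by blast+
  have up: "(w, Suc i) \<in> C"
    if "length w = r" "i < r" "even i"
      and lower: "\<And>v j. length v = r \<Longrightarrow> i = Suc j \<Longrightarrow> (v, j) \<in> C" for w i
  proof (cases "w ! i")
    case False
    with that rung show ?thesis by blast
  next
    case True
    with that(1-3) have flipped: "(flip i w, i) \<in> C" "(flip i w, Suc i) \<in> C"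
      by (auto intro!: rung simp: nth_flip)
    show ?thesis
      by (rule forced[of "(flip i w, i)"]) (use that flipped in \<open>auto simp: nbhd_BF_edges\<close>)
  qed
  \<comment> \<open>Mirror image of \<open>up\<close>: the forcing vertex is now
    \<open>(flip i w, Suc i)\<close>, and the level above it, if there is one, must be full.\<close>
  have down: "(w, i) \<in> C"
    if "length w = r" "i < r" "even i"
      "\<And>v. length v = r \<Longrightarrow> Suc i < r \<Longrightarrow> (v, Suc (Suc i)) \<in> C" for w i
  proof (cases "w ! i")
    case False
    with that rung show ?thesis by blast
  next
    case True
    with that(1-3) have flipped: "(flip i w, i) \<in> C" "(flip i w, Suc i) \<in> C"
      by (auto intro!: rung simp: nth_flip)
    show ?thesis
      by (rule forced[of "(flip i w, Suc i)"]) (use that flipped in \<open>auto simp: nbhd_BF_edges\<close>)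
  qed
  have odd_level: "(w, Suc (2 * k)) \<in> C" if "length w = r" "2 * k < r" for w k
    using that
  proof (induction k arbitrary: w)
    case 0
    show ?case by (rule up) (use 0 in auto)
  next
    case (Suc k)
    show ?case by (rule up) (use Suc in auto)
  qed
  \<comment> \<open>Oddness enters here: the highest even level \<open>2 * m\<close> is paired with
    level \<open>r\<close> itself, so the downward induction starts with no level above the
    pair.\<close>
  from assms obtain m where m: "r = Suc (2 * m)" by (auto elim: oddE)
  have even_level: "(w, 2 * k) \<in> C" if "length w = r" "k \<le> m" for w k
    using that(2,1)
  proof (induction k arbitrary: w rule: inc_induct)
    case base
    show ?case by (rule down) (use base m in auto)
  next
    case (step k)
    show ?case
    proof (rule down)
      show "(v, Suc (Suc (2 * k))) \<in> C" if "length v = r" for v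
        using step.IH[OF that] by simp
    qed (use step m in auto)
  qed
  have "BF_verts r \<subseteq> C"
  proof
    fix x assume "x \<in> BF_verts r"
    then obtain w i where x: "x = (w, i)" "length w = r" "i \<le> r" by (auto simp: BF_verts_def)
    show "x \<in> C"
    proof (cases "even i")
      case True
      then obtain k where "i = 2 * k" by blast
      with x m even_level[of w k] show ?thesis by auto
    next
      case False
      then obtain k where "i = Suc (2 * k)" by (auto elim: oddE)
      with x odd_level[of w k] show ?thesis by auto
    qed
  qed
  moreover have "\<nexists>D'. force_step (BF_edges r) (BF_verts r) D'"
    using Union_BF_edges_subset[of r] unfolding force_step_def nbhd_def by blast
  then have "C \<subseteq> BF_verts r"
    unfolding C_def by (rule forcing_closure_least[OF closure T])
  ultimately show ?thesis by (simp add: C_def)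
qed

lemma edge_forcing_set_rungs:
  assumes "odd r"
  shows "edge_forcing_set (BF_verts r) (BF_edges r) (rungs r)"
  by (simp add: edge_forcing_set_def rungs_subset_BF_edges pairwise_disjnt_rungs
      forcing_closure_rungs assms)

theorem theorem4p9:
  fixes r :: nat
  assumes "odd r" and "r \<ge> 3"
  shows "2 ^ r \<le> int (edge_forcing_number (BF_verts r) (BF_edges r)) \<and>
         int (edge_forcing_number (BF_verts r) (BF_edges r)) \<le> \<lceil>real r / 2\<rceil> * 2 ^ (r - 1)"
proof -
  let ?P = "\<lambda>n. \<exists>K. edge_forcing_set (BF_verts r) (BF_edges r) K \<and> card K = n"
  let ?z = "edge_forcing_number (BF_verts r) (BF_edges r)"
  have rungs: "?P (card (rungs r))" using edge_forcing_set_rungs[OF assms(1)] by blast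
  \<comment> \<open>The minimum is attained because \<open>rungs r\<close> shows that edge-forcing
    sets exist.\<close>
  then have "?P ?z" unfolding edge_forcing_number_def by (rule LeastI)
  then have "2 ^ r \<le> ?z" using edge_forcing_set_BF_card_ge assms(2) by fastforce
  then have lower: "2 ^ r \<le> int ?z" by (metis of_nat_le_iff of_nat_numeral of_nat_power)
  obtain m where m: "r = Suc (2 * m)" using assms(1) by (auto elim: oddE)
  have "\<lceil>real r / 2\<rceil> = int (Suc r div 2)" unfolding m by (simp add: ceiling_eq_iff)
  moreover have "?z \<le> card (rungs r)"
    unfolding edge_forcing_number_def using rungs by (rule Least_le)
  then have "?z \<le> Suc r div 2 * 2 ^ (r - 1)" using card_rungs_le le_trans by blast
  then have "int ?z \<le> int (Suc r div 2 * 2 ^ (r - 1))" by (rule of_nat_mono)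
  ultimately have "int ?z \<le> \<lceil>real r / 2\<rceil> * 2 ^ (r - 1)" by simp
  with lower show ?thesis by blast
qed

end
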